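(* For every H-context $H$ there is a unique head canonical H-context $H_c$ with $H_c \sim_E H$. More precisely: (1) for every H-context $H$ there are a unique sequence of spine variables $x_1,\ldots,x_n$, a unique sequence of spine arguments $t_1,\ldots,t_m$, and a unique sequence of E-contexts $E_0,E_1,\ldots,E_{n+m}$ such that $H=E_0[H_1]$, $H_i=\lambda x_i.E_i[H_{i+1}]$ for $1\le i\le n$, $H_{n+j}=E_{n+j}[H_{n+j+1}]\,t_{m-j+1}$ for $1\le j\le m$, and $H_{n+m+1}=\square$; that is, $$H = E_0[\lambda x_1.E_1[\lambda x_2.E_2[\ldots[\lambda x_n.E_n[E_{n+1}[\ldots[E_{n+m-1}[E_{n+m}\,t_1]t_2]\ldots]t_m]]\ldots]]];$$ (2) the unique head canonical H-context $H_c\sim_E H$ is $H_c=\lambda x_1.\ldots\lambda x_n.\,E_c[\square\,t_1\ldots t_m]$, where $E_c=\widetilde{E}_0[\widetilde{E}_1[\ldots[\widetilde{E}_{n+m}]]]$ and $\widetilde{E}_i=\mathcal{E}(\eta(E_i))$ is the unique head canonical E-context with $\widetilde{E}_i\sim_E E_i$; (3) $H_c$ is the unique normal form of $H$ for the rewriting system $\to_E$ on H-contexts.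
   Context: $\lambda$-terms: $s,t ::= x \mid \lambda x.t \mid st$, modulo $\alpha$-conversion with the distinct names convention; $\mathsf{FV}$ denotes free variables (for a context, free variables of the context ignoring the hole). Contexts have one hole $\square$; plugging $C[\cdot]$ is without renaming. H-contexts: $H ::= \square \mid \lambda x.H \mid H\,t$. The spine of an H-context consists of the abstractions/applications on the path from the hole to the root; spine variables: $\mathsf{SV}(\square)=\emptyset$, $\mathsf{SV}(\lambda x.H)=\{x\}\cup\mathsf{SV}(H)$, $\mathsf{SV}(Ht)=\mathsf{SV}(H)$; spine arguments: the terms $t$ of the spine applications $H\,t$. A $\lambda$-context $H_\lambda$ is an H-context with only abstractions on its spine ($\lambda x_1.\ldots\lambda x_n.\square$); an $@$-context $H_@$ is an H-context with only applications on its spine ($\square\,t_1\ldots t_m$). E-contexts: $E ::= \square \mid E_1[\lambda x.E_2]\,t$. Head canonical E-contexts: $E_c ::= \square \mid (\lambda x.E_c)t$. A head canonical H-context is one of the form $H_\lambda[E_c[H_@]]$ with $H_\lambda$ a $\lambda$-context, $E_c$ a head canonical E-context, $H_@$ an $@$-context. Environments: finite sequences $t_1/x_1,\ldots,t_k/x_k$; $\eta(\square)=\epsilon$, $\eta(E_1[\lambda x.E_2]t)=\eta(E_2),t/x,\eta(E_1)$; $\mathcal{E}(\epsilon)=\square$, $\mathcal{E}(t/x,\eta)=\mathcal{E}(\eta)[(\lambda x.\square)t]$. Surface E-equivalence on E-contexts: least equivalence with $E_1[\lambda x.E_2]t\sim_E E_1[(\lambda x.E_2)t]$ if $\mathsf{FV}(t)\cap\mathsf{SV}(E_1)=\emptyset$,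 and $E_1[E_2]\sim_E E_1'[E_2']$ if $E_i\sim_E E_i'$ ($i=1,2$). Surface E-equivalence on terms is the least equivalence containing the previous rules and $H_\lambda[E[\lambda x.s]]\sim_E H_\lambda[\lambda x.E[s]]$ if $x\notin\mathsf{FV}(E)$; $H_\lambda[E[s]\,t]\sim_E H_\lambda[E[s\,t]]$ if $\mathsf{FV}(t)\cap\mathsf{SV}(E)=\emptyset$; $H_\lambda[E_1[s]]\sim_E H_\lambda[E_2[s]]$ if $E_1\sim_E E_2$ (where $H_\lambda$ is a $\lambda$-context and $E,E_1,E_2$ E-contexts); it is extended to H-contexts by putting $\square$ in place of $s$. The rewriting system $\to_E$ is obtained by orienting these rules left to right: on E-contexts, $E_1[\lambda x.E_2]t\to_E E_1[(\lambda x.E_2)t]$ if $\mathsf{FV}(t)\cap\mathsf{SV}(E_1)=\emptyset$, and $E_1[E_2]\to_E E_1'[E_2']$ if for some $i\ne j$ in $\{1,2\}$, $E_i\to_E E_i'$ and $E_j=E_j'$; on terms/H-contexts, $H_\lambda[E[\lambda x.s]]\to_E H_\lambda[\lambda x.E[s]]$ if $x\notin\mathsf{FV}(E)$, $H_\lambda[E[s]t]\to_E H_\lambda[E[st]]$ if $\mathsf{FV}(t)\cap\mathsf{SV}(E)=\emptyset$, and $H_\lambda[E_1[s]]\to_E H_\lambda[E_2[s]]$ if $E_1\to_E E_2$ (with $\square$ in place of $s$ for H-contexts).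
   Formalization: The rule H_λ[E[s]t] ~_E H_λ[E[st]] and its orientation are taken under any H-context in place of H_λ, since otherwise ((λy.□)b)c d is equivalent only to itself and not head canonical; identity instances of →_E (E = □ or E_1 = □) are excluded. *)

theory Defs
  imports "HOL-Combinatorics.Transposition"
begin

type_synonym var = nat

datatype raw = RVar var | RLam var raw | RApp raw raw

primrec rfv :: "raw \<Rightarrow> var set" where
  "rfv (RVar x) = {x}"
| "rfv (RLam x s) = rfv s - {x}"
| "rfv (RApp s t) = rfv s \<union> rfv t"

primrec rswap :: "var \<Rightarrow> var \<Rightarrow> raw \<Rightarrow> raw" where
  "rswap x y (RVar z) = RVar (transpose x y z)"
| "rswap x y (RLam z s) = RLam (transpose x y z) (rswap x y s)"
| "rswap x y (RApp s t) = RApp (rswap x y s) (rswap x y t)"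

inductive alpha :: "raw \<Rightarrow> raw \<Rightarrow> bool" where
  refl: "alpha s s"
| sym: "alpha s t \<Longrightarrow> alpha t s"
| trans: "alpha s t \<Longrightarrow> alpha t u \<Longrightarrow> alpha s u"
| lam: "alpha s t \<Longrightarrow> alpha (RLam x s) (RLam x t)"
| app: "alpha s s' \<Longrightarrow> alpha t t' \<Longrightarrow> alpha (RApp s t) (RApp s' t')"
| rename: "y \<notin> rfv s \<Longrightarrow> alpha (RLam x s) (RLam y (rswap x y s))"

lemma rfv_rswap: "rfv (rswap x y s) = transpose x y ` rfv s"
proof (induction s)
  case (RLam z s)
  have "inj (transpose x y)" by simp
  then show ?case using RLam by (simp add: image_set_diff)
qed auto

lemma rfv_alpha: "alpha s t \<Longrightarrow> rfv s = rfv t"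
proof (induction rule: alpha.induct)
  case (rename y s x)
  then show ?case
    by (auto simp: rfv_rswap transpose_def image_iff split: if_splits)
qed auto

quotient_type trm = raw / alpha
  by (rule equivpI) (auto intro!: reflpI sympI transpI intro: alpha.intros)

lift_definition fv :: "trm \<Rightarrow> var set" is rfv
  by (rule rfv_alpha)

text \<open>
  Arguments are terms up to alpha. The spine of a context binds variables of
  whatever is plugged into the hole, so its bound names are part of the context
  and plugging captures.
\<close>

datatype hctx = Hole  (\<open>\<box>\<close>) | HLam var hctx | HApp hctx trm

primrec hplug :: "hctx \<Rightarrow> hctx \<Rightarrow> hctx"  (\<open>_\<langle>_\<rangle>\<close> [1000, 0] 1000) where
  "\<box>\<langle>K\<rangle> = K"
| "(HLam x H)\<langle>K\<rangle> = HLam x (H\<langle>K\<rangle>)"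
| "(HApp H t)\<langle>K\<rangle> = HApp (H\<langle>K\<rangle>) t"

primrec FV :: "hctx \<Rightarrow> var set" where
  "FV \<box> = {}"
| "FV (HLam x H) = FV H - {x}"
| "FV (HApp H t) = FV H \<union> fv t"

primrec SV :: "hctx \<Rightarrow> var set" where
  "SV \<box> = {}"
| "SV (HLam x H) = {x} \<union> SV H"
| "SV (HApp H t) = SV H"

primrec spine_args :: "hctx \<Rightarrow> trm set" where
  "spine_args \<box> = {}"
| "spine_args (HLam x H) = spine_args H"
| "spine_args (HApp H t) = {t} \<union> spine_args H"

primrec distinct_spine :: "hctx \<Rightarrow> bool" where
  "distinct_spine \<box> = True"
| "distinct_spine (HLam x H) = (x \<notin> SV H \<and> distinct_spine H)"
| "distinct_spine (HApp H t) = distinct_spine H"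

text \<open>
  The distinct names convention. Names bound inside arguments do not occur
  here, since arguments are taken up to alpha.
\<close>

definition distinct_names :: "hctx \<Rightarrow> bool" where
  "distinct_names H \<longleftrightarrow> distinct_spine H \<and> SV H \<inter> FV H = {}"

primrec is_lam_ctx :: "hctx \<Rightarrow> bool" where
  "is_lam_ctx \<box> = True"
| "is_lam_ctx (HLam x H) = is_lam_ctx H"
| "is_lam_ctx (HApp H t) = False"

primrec is_app_ctx :: "hctx \<Rightarrow> bool" where
  "is_app_ctx \<box> = True"
| "is_app_ctx (HLam x H) = False"
| "is_app_ctx (HApp H t) = is_app_ctx H"

text \<open>
  E-contexts, as derivations of their grammar: \<open>EApp E\<^sub>1 x E\<^sub>2 t\<close> stands for
  the context \<open>E\<^sub>1[\<lambda>x. E\<^sub>2] t\<close>. The map \<open>ctx\<close> below gives the H-context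
  itself; the grammar is unambiguous (\<open>inj_ctx\<close>), so nothing is
  lost by identifying the two.
\<close>

datatype ectx = EHole | EApp ectx var ectx trm

primrec ctx :: "ectx \<Rightarrow> hctx" where
  "ctx EHole = \<box>"
| "ctx (EApp E\<^sub>1 x E\<^sub>2 t) = HApp ((ctx E\<^sub>1)\<langle>HLam x (ctx E\<^sub>2)\<rangle>) t"

primrec eplug :: "ectx \<Rightarrow> ectx \<Rightarrow> ectx" where
  "eplug EHole F = F"
| "eplug (EApp E\<^sub>1 x E\<^sub>2 t) F = EApp E\<^sub>1 x (eplug E\<^sub>2 F) t"

lemma hplug_assoc: "(H\<langle>K\<rangle>)\<langle>L\<rangle> = H\<langle>K\<langle>L\<rangle>\<rangle>"
  by (induction H) auto

lemma ctx_eplug: "ctx (eplug E F) = (ctx E)\<langle>ctx F\<rangle>"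
  by (induction E) (auto simp: hplug_assoc)

lemma hplug_Hole: "H\<langle>\<box>\<rangle> = H"
  by (induction H) auto

lemma ctx_hplug_cancel:
  assumes "\<And>A t. K \<noteq> HApp A t" "\<And>A t. K' \<noteq> HApp A t"
    and "(ctx E)\<langle>K\<rangle> = (ctx E')\<langle>K'\<rangle>"
  shows "E = E' \<and> K = K'"
  using assms
proof (induction E arbitrary: E' K K')
  case EHole
  then show ?case by (cases E') auto
next
  case (EApp E\<^sub>1 x E\<^sub>2 t)
  from EApp.prems obtain F\<^sub>1 y F\<^sub>2 u where E': "E' = EApp F\<^sub>1 y F\<^sub>2 u"
    by (cases E') auto
  have eq: "(ctx E\<^sub>1)\<langle>HLam x ((ctx E\<^sub>2)\<langle>K\<rangle>)\<rangle> = (ctx F\<^sub>1)\<langle>HLam y ((ctx F\<^sub>2)\<langle>K'\<rangle>)\<rangle>" "t = u"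
    using EApp.prems(3) by (auto simp: E' hplug_assoc)
  have 1: "E\<^sub>1 = F\<^sub>1 \<and> HLam x ((ctx E\<^sub>2)\<langle>K\<rangle>) = HLam y ((ctx F\<^sub>2)\<langle>K'\<rangle>)"
    by (rule EApp.IH(1)) (use eq in auto)
  then have "E\<^sub>2 = F\<^sub>2 \<and> K = K'"
    by (intro EApp.IH(2) EApp.prems(1,2)) auto
  with 1 eq E' show ?case by auto
qed

lemma inj_ctx: "inj ctx"
  using ctx_hplug_cancel[of "\<box>" "\<box>"] by (auto intro!: injI simp: hplug_Hole)

primrec canonical_ectx :: "ectx \<Rightarrow> bool" where
  "canonical_ectx EHole = True"
| "canonical_ectx (EApp E\<^sub>1 x E\<^sub>2 t) = (E\<^sub>1 = EHole \<and> canonical_ectx E\<^sub>2)"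

definition canonical_hctx :: "hctx \<Rightarrow> bool" where
  "canonical_hctx H \<longleftrightarrow>
     (\<exists>L E A. is_lam_ctx L \<and> canonical_ectx E \<and> is_app_ctx A \<and> H = L\<langle>(ctx E)\<langle>A\<rangle>\<rangle>)"

type_synonym env = "(trm \<times> var) list"

primrec env_of :: "ectx \<Rightarrow> env"  (\<open>\<eta>\<close>) where
  "\<eta> EHole = []"
| "\<eta> (EApp E\<^sub>1 x E\<^sub>2 t) = \<eta> E\<^sub>2 @ [(t, x)] @ \<eta> E\<^sub>1"

fun ectx_of_env :: "env \<Rightarrow> ectx"  (\<open>\<E>\<close>) where
  "\<E> [] = EHole"
| "\<E> ((t, x) # e) = eplug (\<E> e) (EApp EHole x EHole t)"

inductive sim_ectx :: "ectx \<Rightarrow> ectx \<Rightarrow> bool"  (infix \<open>\<sim>\<^sub>E\<close> 50) where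
  refl: "E \<sim>\<^sub>E E"
| sym: "E \<sim>\<^sub>E F \<Longrightarrow> F \<sim>\<^sub>E E"
| trans: "E \<sim>\<^sub>E F \<Longrightarrow> F \<sim>\<^sub>E G \<Longrightarrow> E \<sim>\<^sub>E G"
| arg: "fv t \<inter> SV (ctx E\<^sub>1) = {} \<Longrightarrow> EApp E\<^sub>1 x E\<^sub>2 t \<sim>\<^sub>E eplug E\<^sub>1 (EApp EHole x E\<^sub>2 t)"
| plug: "E\<^sub>1 \<sim>\<^sub>E E\<^sub>1' \<Longrightarrow> E\<^sub>2 \<sim>\<^sub>E E\<^sub>2' \<Longrightarrow> eplug E\<^sub>1 E\<^sub>2 \<sim>\<^sub>E eplug E\<^sub>1' E\<^sub>2'"

text \<open>
  On H-contexts the rule \<open>app\<close> may be used below an arbitrary H-context \<open>H\<close>,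
  whereas \<open>lam\<close> and \<open>ectx\<close> are used below lambda-contexts only. If \<open>app\<close> were
  restricted to lambda-contexts, then \<open>((\<lambda>y.\<box>) b) c d\<close> would be equivalent only to
  itself, hence to no head canonical H-context. If \<open>lam\<close> were allowed below
  applications, then (for \<open>y\<close> not free in \<open>t\<close>) \<open>(\<lambda>y.\<lambda>x.\<box>) b t\<close> would be equivalent
  to two head canonical H-contexts: \<open>(\<lambda>x.(\<lambda>y.\<box>) b) t\<close> and, by \<open>arg\<close>,
  \<open>(\<lambda>y.(\<lambda>x.\<box>) t) b\<close>.
\<close>

inductive sim_hctx :: "hctx \<Rightarrow> hctx \<Rightarrow> bool"  (infix \<open>\<sim>\<^sub>H\<close> 50) where
  refl: "H \<sim>\<^sub>H H"
| sym: "H \<sim>\<^sub>H K \<Longrightarrow> K \<sim>\<^sub>H H"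
| trans: "H \<sim>\<^sub>H K \<Longrightarrow> K \<sim>\<^sub>H L \<Longrightarrow> H \<sim>\<^sub>H L"
| lam: "is_lam_ctx L \<Longrightarrow> x \<notin> FV (ctx E) \<Longrightarrow>
    L\<langle>(ctx E)\<langle>HLam x S\<rangle>\<rangle> \<sim>\<^sub>H L\<langle>HLam x ((ctx E)\<langle>S\<rangle>)\<rangle>"
| app: "fv t \<inter> SV (ctx E) = {} \<Longrightarrow>
    H\<langle>HApp ((ctx E)\<langle>S\<rangle>) t\<rangle> \<sim>\<^sub>H H\<langle>(ctx E)\<langle>HApp S t\<rangle>\<rangle>"
| ectx: "is_lam_ctx L \<Longrightarrow> E\<^sub>1 \<sim>\<^sub>E E\<^sub>2 \<Longrightarrow>
    L\<langle>(ctx E\<^sub>1)\<langle>S\<rangle>\<rangle> \<sim>\<^sub>H L\<langle>(ctx E\<^sub>2)\<langle>S\<rangle>\<rangle>"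

text \<open>
  The same rules, oriented. For \<open>E\<^sub>1 = \<box>\<close> in \<open>arg\<close>, and for \<open>E = \<box>\<close> in \<open>lam\<close>
  and \<open>app\<close>, both sides coincide; these instances are excluded, since otherwise
  hardly any context would be a normal form.
\<close>

inductive step_ectx :: "ectx \<Rightarrow> ectx \<Rightarrow> bool"  (infix \<open>\<rightarrow>\<^sub>E\<close> 50) where
  arg: "E\<^sub>1 \<noteq> EHole \<Longrightarrow> fv t \<inter> SV (ctx E\<^sub>1) = {} \<Longrightarrow>
    EApp E\<^sub>1 x E\<^sub>2 t \<rightarrow>\<^sub>E eplug E\<^sub>1 (EApp EHole x E\<^sub>2 t)"
| plug1: "E\<^sub>1 \<rightarrow>\<^sub>E E\<^sub>1' \<Longrightarrow> eplug E\<^sub>1 E\<^sub>2 \<rightarrow>\<^sub>E eplug E\<^sub>1' E\<^sub>2"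
| plug2: "E\<^sub>2 \<rightarrow>\<^sub>E E\<^sub>2' \<Longrightarrow> eplug E\<^sub>1 E\<^sub>2 \<rightarrow>\<^sub>E eplug E\<^sub>1 E\<^sub>2'"

inductive step_hctx :: "hctx \<Rightarrow> hctx \<Rightarrow> bool"  (infix \<open>\<rightarrow>\<^sub>H\<close> 50) where
  lam: "is_lam_ctx L \<Longrightarrow> E \<noteq> EHole \<Longrightarrow> x \<notin> FV (ctx E) \<Longrightarrow>
    L\<langle>(ctx E)\<langle>HLam x S\<rangle>\<rangle> \<rightarrow>\<^sub>H L\<langle>HLam x ((ctx E)\<langle>S\<rangle>)\<rangle>"
| app: "E \<noteq> EHole \<Longrightarrow> fv t \<inter> SV (ctx E) = {} \<Longrightarrow>
    H\<langle>HApp ((ctx E)\<langle>S\<rangle>) t\<rangle> \<rightarrow>\<^sub>H H\<langle>(ctx E)\<langle>HApp S t\<rangle>\<rangle>"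
| ectx: "is_lam_ctx L \<Longrightarrow> E\<^sub>1 \<rightarrow>\<^sub>E E\<^sub>2 \<Longrightarrow>
    L\<langle>(ctx E\<^sub>1)\<langle>S\<rangle>\<rangle> \<rightarrow>\<^sub>H L\<langle>(ctx E\<^sub>2)\<langle>S\<rangle>\<rangle>"

definition normal_form_of :: "hctx \<Rightarrow> hctx \<Rightarrow> bool" where
  "normal_form_of H N \<longleftrightarrow> step_hctx\<^sup>*\<^sup>* H N \<and> (\<nexists>K. N \<rightarrow>\<^sub>H K)"

text \<open>
  \<open>xs = [x\<^sub>1,\<dots>,x\<^sub>n]\<close>, \<open>ts = [t\<^sub>1,\<dots>,t\<^sub>m]\<close>, \<open>Es = [E\<^sub>0,\<dots>,E\<^bsub>n+m\<^esub>]\<close>; lists are indexed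
  from 0, so \<open>x\<^sub>i\<close> is \<open>xs ! (i - 1)\<close> and \<open>t\<^bsub>m-j+1\<^esub>\<close> is \<open>ts ! (m - j)\<close>.
\<close>

definition decomposition :: "hctx \<Rightarrow> var list \<Rightarrow> trm list \<Rightarrow> ectx list \<Rightarrow> bool" where
  "decomposition H xs ts Es \<longleftrightarrow>
     (let n = length xs; m = length ts in
        set xs \<subseteq> SV H \<and> set ts \<subseteq> spine_args H \<and> length Es = n + m + 1 \<and>
        (\<exists>Hs :: nat \<Rightarrow> hctx.
           H = (ctx (Es ! 0))\<langle>Hs 1\<rangle> \<and>
           (\<forall>i\<in>{1..n}. Hs i = HLam (xs ! (i - 1)) ((ctx (Es ! i))\<langle>Hs (i + 1)\<rangle>)) \<and>
           (\<forall>j\<in>{1..m}. Hs (n + j) =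
              HApp ((ctx (Es ! (n + j)))\<langle>Hs (n + j + 1)\<rangle>) (ts ! (m - j))) \<and>
           Hs (n + m + 1) = \<box>))"

definition lams :: "var list \<Rightarrow> hctx \<Rightarrow> hctx" where
  "lams xs K = foldr HLam xs K"

definition apps :: "trm list \<Rightarrow> hctx" where
  "apps ts = foldl HApp \<box> ts"

definition compose :: "ectx list \<Rightarrow> ectx" where
  "compose Es = foldr eplug Es EHole"

end

theory Submission
  imports Defs
begin

text \<open>
  Reading the spine from the root to the hole, an application is an opening and an abstraction a
  closing parenthesis. E-contexts are the balanced words, so matching parentheses decomposes every
  H-context uniquely; what remains unmatched is a sequence of abstractions followed by a sequence
  of applications. The unmatched abstractions, the unmatched applications and the concatenation of
  the environments of all balanced blocks are invariant under the equivalence and determine a head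
  canonical context. Each rewriting step preserves the naming convention and decreases the number
  of pairs of a spine application above a spine abstraction, and under the convention every
  context that is not head canonical can be rewritten. A head canonical context is therefore a
  normal form: after a step one could continue to a head canonical context with the same
  invariant, hence to the context one started from, although the number of pairs has decreased.
\<close>

section \<open>Free and spine variables\<close>

lemma SV_hplug: "SV (H\<langle>K\<rangle>) = SV H \<union> SV K"
  by (induction H) auto

lemma FV_hplug: "FV (H\<langle>K\<rangle>) = FV H \<union> (FV K - SV H)"
  by (induction H) auto

lemma distinct_spine_hplug:
  "distinct_spine (H\<langle>K\<rangle>) \<longleftrightarrow> distinct_spine H \<and> distinct_spine K \<and> SV H \<inter> SV K = {}"
  by (induction H) (auto simp: SV_hplug)

lemmas names_hplug = SV_hplug FV_hplug distinct_spine_hplug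

text \<open>A free variable of \<open>K\<close> that is not free in the whole context is captured by
  \<open>H\<close>, and \<open>SV H\<close> is disjoint from \<open>SV K\<close> because spine names
  are distinct.\<close>

lemma distinct_names_hplugD:
  assumes "distinct_names (H\<langle>K\<rangle>)"
  shows "distinct_names H" "distinct_names K"
  using assms by (auto simp: distinct_names_def names_hplug)

text \<open>In \<open>arg\<close> the argument passes below binders of variables not free in it, so
  nothing is captured or released. The naming convention thus travels along the equivalence.\<close>

lemma sim_ectx_names:
  "E \<sim>\<^sub>E F \<Longrightarrow> SV (ctx E) = SV (ctx F) \<and> FV (ctx E) = FV (ctx F) \<and>
     distinct_spine (ctx E) = distinct_spine (ctx F)"
proof (induction rule: sim_ectx.induct)
  case (arg t E\<^sub>1 x E\<^sub>2)
  then show ?case by (auto simp: ctx_eplug names_hplug)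
qed (auto simp: ctx_eplug names_hplug)

lemma sim_hctx_names:
  "H \<sim>\<^sub>H K \<Longrightarrow> SV H = SV K \<and> FV H = FV K \<and> distinct_spine H = distinct_spine K"
proof (induction rule: sim_hctx.induct)
  case (ectx L E\<^sub>1 E\<^sub>2 S)
  then show ?case using sim_ectx_names by (auto simp: names_hplug)
qed (auto simp: names_hplug)

lemma sim_hctx_distinct_names: "H \<sim>\<^sub>H K \<Longrightarrow> distinct_names H \<longleftrightarrow> distinct_names K"
  using sim_hctx_names by (auto simp: distinct_names_def)

section \<open>Environments and canonical E-contexts\<close>

lemma eplug_EHole [simp]: "eplug E EHole = E"
  by (induction E) auto

lemma eplug_assoc: "eplug (eplug E F) G = eplug E (eplug F G)"
  by (induction E) auto

lemma eplug_eq_EHole [simp]: "eplug E F = EHole \<longleftrightarrow> E = EHole \<and> F = EHole"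
  by (cases E) auto

lemma env_of_eplug: "\<eta> (eplug E F) = \<eta> F @ \<eta> E"
  by (induction E) auto

lemma canonical_eplug: "canonical_ectx (eplug E F) \<longleftrightarrow> canonical_ectx E \<and> canonical_ectx F"
  by (induction E) auto

lemma ectx_of_env_append: "\<E> (e @ e') = eplug (\<E> e') (\<E> e)"
  by (induction e rule: ectx_of_env.induct) (auto simp: eplug_assoc)

lemma env_of_ectx_of_env [simp]: "\<eta> (\<E> e) = e"
  by (induction e rule: ectx_of_env.induct) (auto simp: env_of_eplug)

lemma canonical_ectx_of_env: "canonical_ectx (\<E> e)"
  by (induction e rule: ectx_of_env.induct) (auto simp: canonical_eplug)

lemma ectx_of_env_of_canonical: "canonical_ectx E \<Longrightarrow> \<E> (\<eta> E) = E"
  by (induction E) (auto simp: ectx_of_env_append)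

text \<open>Both sides of \<open>arg\<close> have environment
  \<open>\<eta> E\<^sub>2 @ [(t, x)] @ \<eta> E\<^sub>1\<close>, and plugging becomes concatenation
  in reverse order.\<close>

lemma sim_ectx_env: "E \<sim>\<^sub>E F \<Longrightarrow> \<eta> E = \<eta> F"
  by (induction rule: sim_ectx.induct) (auto simp: env_of_eplug)

text \<open>The variables of \<open>t\<close> are free in the whole context, so the naming
  convention provides the side condition of \<open>arg\<close>. Once \<open>t\<close> has passed
  \<open>E\<^sub>1\<close>, the two parts are normalised separately.\<close>

lemma sim_ectx_of_env_of: "distinct_names (ctx E) \<Longrightarrow> E \<sim>\<^sub>E \<E> (\<eta> E)"
proof (induction E)
  case EHole
  then show ?case by (auto intro: sim_ectx.refl)
next
  case (EApp E\<^sub>1 x E\<^sub>2 t)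
  have dis: "fv t \<inter> SV (ctx E\<^sub>1) = {}"
    and "distinct_names (ctx E\<^sub>1)" "distinct_names (ctx E\<^sub>2)"
    using EApp.prems by (auto simp: distinct_names_def names_hplug)
  then have IH: "E\<^sub>1 \<sim>\<^sub>E \<E> (\<eta> E\<^sub>1)" "E\<^sub>2 \<sim>\<^sub>E \<E> (\<eta> E\<^sub>2)"
    using EApp.IH by auto
  have "eplug (EApp EHole x EHole t) E\<^sub>2 \<sim>\<^sub>E eplug (EApp EHole x EHole t) (\<E> (\<eta> E\<^sub>2))"
    by (rule sim_ectx.plug[OF sim_ectx.refl IH(2)])
  then have "eplug E\<^sub>1 (EApp EHole x E\<^sub>2 t)
      \<sim>\<^sub>E eplug (\<E> (\<eta> E\<^sub>1)) (EApp EHole x (\<E> (\<eta> E\<^sub>2)) t)"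
    using IH(1) by (auto intro: sim_ectx.plug)
  then show ?case
    using sim_ectx.trans[OF sim_ectx.arg[OF dis]]
    by (simp add: ectx_of_env_append eplug_assoc)
qed

lemma canonical_sim_ectx_iff:
  assumes "distinct_names (ctx E)"
  shows "canonical_ectx F \<and> F \<sim>\<^sub>E E \<longleftrightarrow> F = \<E> (\<eta> E)"
  using sim_ectx_of_env_of[OF assms] sim_ectx_env[of F E] ectx_of_env_of_canonical[of F]
    canonical_ectx_of_env[of "\<eta> E"] sim_ectx.sym by metis

lemma env_of_compose: "\<eta> (compose Es) = concat (rev (map \<eta> Es))"
  by (induction Es) (auto simp: compose_def env_of_eplug)

lemma canonical_compose: "(\<And>E. E \<in> set Es \<Longrightarrow> canonical_ectx E) \<Longrightarrow> canonical_ectx (compose Es)"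
  by (induction Es) (auto simp: compose_def canonical_eplug)

section \<open>The invariant of the equivalence\<close>

text \<open>
  Unmatched abstractions, unmatched arguments in the order of \<^const>\<open>apps\<close>, and the
  environments between consecutive unmatched abstractions. Blocks separated only by unmatched
  applications are merged. The environments have to be kept apart here because a further
  application at the root is matched with the first abstraction and is inserted after the
  first environment.
\<close>

primrec profile :: "hctx \<Rightarrow> var list \<times> trm list \<times> env list" where
  "profile \<box> = ([], [], [[]])"
| "profile (HLam x H) = (case profile H of (xs, ts, es) \<Rightarrow> (x # xs, ts, [] # es))"
| "profile (HApp H t) = (case profile H of (xs, ts, es) \<Rightarrow>
     (case xs of
        [] \<Rightarrow> ([], ts @ [t], es)
      | x # xs' \<Rightarrow> (xs', ts, ((es ! 1) @ (t, x) # es ! 0) # drop 2 es)))"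

definition invariant :: "hctx \<Rightarrow> var list \<times> trm list \<times> env" where
  "invariant H = (case profile H of (xs, ts, es) \<Rightarrow> (xs, ts, concat (rev es)))"

lemma length_profile: "profile H = (xs, ts, es) \<Longrightarrow> length es = Suc (length xs)"
  by (induction H arbitrary: xs ts es) (auto split: prod.splits list.splits)

text \<open>A balanced block only extends the first environment: its inner abstraction starts a new
  one, which \<open>E\<^sub>1\<close> fills and the outer argument merges with the next.\<close>

lemma profile_ctx_hplug:
  "profile H = (xs, ts, e # es) \<Longrightarrow> profile ((ctx E)\<langle>H\<rangle>) = (xs, ts, (e @ \<eta> E) # es)"
  by (induction E arbitrary: H xs e es) (auto simp: hplug_assoc)

lemma invariant_cong_profile:
  assumes "profile K = profile K'"
  shows "invariant (H\<langle>K\<rangle>) = invariant (H\<langle>K'\<rangle>)"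
proof -
  have "profile (H\<langle>K\<rangle>) = profile (H\<langle>K'\<rangle>)"
    using assms by (induction H) auto
  then show ?thesis by (simp add: invariant_def)
qed

lemma obtain_profile:
  obtains xs ts e es where "profile H = (xs, ts, e # es)"
  using length_profile[of H] by (metis length_Suc_conv prod_cases3)

text \<open>An abstraction adds an empty environment, which vanishes in the concatenation. An
  application would depend on where the first environment ends.\<close>

lemma invariant_hplug_cong:
  "is_lam_ctx L \<Longrightarrow> invariant K = invariant K' \<Longrightarrow> invariant (L\<langle>K\<rangle>) = invariant (L\<langle>K'\<rangle>)"
  by (induction L) (auto simp: invariant_def split: prod.splits)

text \<open>The rules \<open>app\<close> and \<open>ectx\<close> preserve the whole profile. The
  rule \<open>lam\<close> moves \<open>\<eta> E\<close> from the first environment to the second,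
  which only the concatenation does not see.\<close>

lemma sim_hctx_invariant: "H \<sim>\<^sub>H K \<Longrightarrow> invariant H = invariant K"
proof (induction rule: sim_hctx.induct)
  case (lam L x E S)
  obtain xs ts e es where "profile S = (xs, ts, e # es)"
    by (rule obtain_profile)
  then have "profile ((ctx E)\<langle>HLam x S\<rangle>) = (x # xs, ts, \<eta> E # e # es)"
    "profile (HLam x ((ctx E)\<langle>S\<rangle>)) = (x # xs, ts, [] # (e @ \<eta> E) # es)"
    using profile_ctx_hplug[of "HLam x S" "x # xs" ts "[]" "e # es" E]
      profile_ctx_hplug[of S xs ts e es E] by simp_all
  then show ?case
    by (intro invariant_hplug_cong lam) (simp add: invariant_def)
next
  case (app t E H S)
  obtain xs ts e es where S: "profile S = (xs, ts, e # es)"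
    by (rule obtain_profile)
  then have "length es = length xs"
    using length_profile by fastforce
  \<comment> \<open>The block \<open>E\<close> has no unmatched abstraction, so \<open>t\<close>
    meets the first unmatched abstraction of \<open>S\<close>, or none, on both sides.\<close>
  have "profile (HApp ((ctx E)\<langle>S\<rangle>) t) = profile ((ctx E)\<langle>HApp S t\<rangle>)"
  proof (cases xs)
    case Nil
    then have "profile (HApp S t) = ([], ts @ [t], e # es)" using S by simp
    from profile_ctx_hplug[OF this, of E] profile_ctx_hplug[OF S, of E] Nil show ?thesis by simp
  next
    case (Cons x xs')
    then obtain e' es' where es: "es = e' # es'"
      using \<open>length es = length xs\<close> by (cases es) auto
    then have "profile (HApp S t) = (xs', ts, (e' @ (t, x) # e) # es')" using S Cons by simp
    from profile_ctx_hplug[OF this, of E] profile_ctx_hplug[OF S, of E] Cons es show ?thesis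
      by simp
  qed
  then show ?case by (rule invariant_cong_profile)
next
  case (ectx L E\<^sub>1 E\<^sub>2 S)
  obtain xs ts e es where "profile S = (xs, ts, e # es)"
    by (rule obtain_profile)
  then have "profile ((ctx E\<^sub>1)\<langle>S\<rangle>) = profile ((ctx E\<^sub>2)\<langle>S\<rangle>)"
    using sim_ectx_env[OF ectx(2)] by (simp add: profile_ctx_hplug)
  then show ?case by (rule invariant_cong_profile)
qed auto

section \<open>Head canonical H-contexts and their invariants\<close>

lemma profile_apps: "profile (apps ts) = ([], ts, [[]])"
  by (induction ts rule: rev_induct) (auto simp: apps_def)

lemma invariant_lams:
  "invariant K = (ys, ts, e) \<Longrightarrow> invariant (lams xs K) = (xs @ ys, ts, e)"
  by (induction xs) (auto simp: lams_def invariant_def split: prod.splits)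

lemma invariant_canonical_form: "invariant (lams xs ((ctx E)\<langle>apps ts\<rangle>)) = (xs, ts, \<eta> E)"
proof -
  have "invariant ((ctx E)\<langle>apps ts\<rangle>) = ([], ts, \<eta> E)"
    using profile_ctx_hplug[OF profile_apps] by (simp add: invariant_def)
  then show ?thesis using invariant_lams by fastforce
qed

lemma is_lam_ctx_lams: "is_lam_ctx (lams xs \<box>)"
  by (induction xs) (auto simp: lams_def)

lemma lams_hplug: "(lams xs H)\<langle>K\<rangle> = lams xs (H\<langle>K\<rangle>)"
  by (induction xs) (auto simp: lams_def)

lemma is_lam_ctxE:
  assumes "is_lam_ctx L"
  obtains xs where "L = lams xs \<box>"
proof -
  from assms have "\<exists>xs. L = lams xs \<box>"
  proof (induction L)
    case Hole
    then show ?case by (auto simp: lams_def intro: exI[of _ "[]"])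
  next
    case (HLam x L)
    then obtain xs where "L = lams xs \<box>" by auto
    then have "HLam x L = lams (x # xs) \<box>" by (simp add: lams_def)
    then show ?case by blast
  qed auto
  then show ?thesis using that by blast
qed

lemma is_app_ctx_apps: "is_app_ctx (apps ts)"
  by (induction ts rule: rev_induct) (auto simp: apps_def)

lemma is_app_ctxE:
  assumes "is_app_ctx A"
  obtains ts where "A = apps ts"
proof -
  from assms have "\<exists>ts. A = apps ts"
  proof (induction A)
    case Hole
    then show ?case by (auto simp: apps_def intro: exI[of _ "[]"])
  next
    case (HApp A t)
    then obtain ts where "A = apps ts" by auto
    then have "HApp A t = apps (ts @ [t])" by (simp add: apps_def)
    then show ?case by blast
  qed auto
  then show ?thesis using that by blast
qed

lemma canonical_hctx_iff:
  "canonical_hctx H \<longleftrightarrow> (\<exists>xs E ts. canonical_ectx E \<and> H = lams xs ((ctx E)\<langle>apps ts\<rangle>))"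
proof
  assume "canonical_hctx H"
  then obtain L E A where *: "is_lam_ctx L" "canonical_ectx E" "is_app_ctx A"
      and H: "H = L\<langle>(ctx E)\<langle>A\<rangle>\<rangle>"
    unfolding canonical_hctx_def by blast
  obtain xs ts where "L = lams xs \<box>" "A = apps ts"
    using *(1,3) by (elim is_lam_ctxE is_app_ctxE)
  then have "H = lams xs ((ctx E)\<langle>apps ts\<rangle>)"
    using H by (simp add: lams_hplug)
  with *(2) show "\<exists>xs E ts. canonical_ectx E \<and> H = lams xs ((ctx E)\<langle>apps ts\<rangle>)" by blast
next
  assume "\<exists>xs E ts. canonical_ectx E \<and> H = lams xs ((ctx E)\<langle>apps ts\<rangle>)"
  then obtain xs E ts where "canonical_ectx E" "H = (lams xs \<box>)\<langle>(ctx E)\<langle>apps ts\<rangle>\<rangle>"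
    by (auto simp: lams_hplug)
  then show "canonical_hctx H"
    unfolding canonical_hctx_def using is_lam_ctx_lams is_app_ctx_apps by blast
qed

text \<open>The invariant consists of the parameters of the canonical form, with \<open>E\<close>
  recovered from its environment by \<open>\<E>\<close>.\<close>

lemma canonical_hctx_eqI:
  assumes "canonical_hctx H" "canonical_hctx K" "invariant H = invariant K"
  shows "H = K"
proof -
  obtain xs E ts where H: "canonical_ectx E" "H = lams xs ((ctx E)\<langle>apps ts\<rangle>)"
    using assms(1) by (auto simp: canonical_hctx_iff)
  obtain ys F us where K: "canonical_ectx F" "K = lams ys ((ctx F)\<langle>apps us\<rangle>)"
    using assms(2) by (auto simp: canonical_hctx_iff)
  have "xs = ys" "ts = us" "\<eta> E = \<eta> F"
    using assms(3) by (auto simp: H K invariant_canonical_form)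
  then show ?thesis
    using H K ectx_of_env_of_canonical by metis
qed

section \<open>Termination\<close>

primrec lam_count :: "hctx \<Rightarrow> nat" where
  "lam_count \<box> = 0"
| "lam_count (HLam x H) = Suc (lam_count H)"
| "lam_count (HApp H t) = lam_count H"

primrec app_count :: "hctx \<Rightarrow> nat" where
  "app_count \<box> = 0"
| "app_count (HLam x H) = app_count H"
| "app_count (HApp H t) = Suc (app_count H)"

primrec inversions :: "hctx \<Rightarrow> nat" where
  "inversions \<box> = 0"
| "inversions (HLam x H) = inversions H"
| "inversions (HApp H t) = inversions H + lam_count H"

lemma lam_count_hplug: "lam_count (H\<langle>K\<rangle>) = lam_count H + lam_count K"
  by (induction H) auto

lemma app_count_hplug: "app_count (H\<langle>K\<rangle>) = app_count H + app_count K"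
  by (induction H) auto

lemma inversions_hplug:
  "inversions (H\<langle>K\<rangle>) = inversions H + inversions K + app_count H * lam_count K"
  by (induction H) (auto simp: lam_count_hplug)

lemmas counts_hplug = lam_count_hplug app_count_hplug inversions_hplug

lemma lam_count_ctx: "lam_count (ctx E) = app_count (ctx E)"
  by (induction E) (auto simp: counts_hplug)

lemma app_count_ctx_pos: "E \<noteq> EHole \<Longrightarrow> 0 < app_count (ctx E)"
  by (cases E) auto

text \<open>In \<open>arg\<close> the pairs of \<open>t\<close> with the abstractions of
  \<open>E\<^sub>1\<close> disappear. The count of applications is carried along because it enters
  the cross term of \<open>inversions_hplug\<close>.\<close>

lemma step_ectx_inversions:
  "E \<rightarrow>\<^sub>E F \<Longrightarrow> inversions (ctx F) < inversions (ctx E) \<and> app_count (ctx F) = app_count (ctx E)"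
proof (induction rule: step_ectx.induct)
  case (arg E\<^sub>1 t x E\<^sub>2)
  then show ?case
    using app_count_ctx_pos[of E\<^sub>1]
    by (auto simp: ctx_eplug counts_hplug lam_count_ctx algebra_simps)
qed (auto simp: ctx_eplug counts_hplug lam_count_ctx)

text \<open>The rule \<open>lam\<close> removes the pairs of \<open>x\<close> with the applications
  of \<open>E\<close>, and \<open>app\<close> those of \<open>t\<close> with its abstractions. Both
  exist since \<open>E\<close> is not the hole.\<close>

lemma step_hctx_inversions: "H \<rightarrow>\<^sub>H K \<Longrightarrow> inversions K < inversions H"
proof (induction rule: step_hctx.induct)
  case (lam L E x S)
  then show ?case using app_count_ctx_pos[of E]
    by (auto simp: counts_hplug)
next
  case (app E t H S)
  then show ?case using app_count_ctx_pos[of E]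
    by (auto simp: counts_hplug lam_count_ctx)
next
  case (ectx L E\<^sub>1 E\<^sub>2 S)
  then show ?case using step_ectx_inversions[of E\<^sub>1 E\<^sub>2]
    by (auto simp: counts_hplug lam_count_ctx)
qed

lemma step_ectx_sim: "E \<rightarrow>\<^sub>E F \<Longrightarrow> E \<sim>\<^sub>E F"
  by (induction rule: step_ectx.induct) (auto intro: sim_ectx.intros)

lemma step_hctx_sim: "H \<rightarrow>\<^sub>H K \<Longrightarrow> H \<sim>\<^sub>H K"
  by (induction rule: step_hctx.induct)
    (auto intro: sim_hctx.lam sim_hctx.app sim_hctx.ectx step_ectx_sim)

lemma steps_hctx_sim: "step_hctx\<^sup>*\<^sup>* H K \<Longrightarrow> H \<sim>\<^sub>H K"
  by (induction rule: rtranclp_induct) (auto intro: sim_hctx.refl sim_hctx.trans step_hctx_sim)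

lemma steps_hctx_inversions: "step_hctx\<^sup>*\<^sup>* H K \<Longrightarrow> inversions K \<le> inversions H"
  by (induction rule: rtranclp_induct) (auto dest: step_hctx_inversions)

section \<open>Progress\<close>

text \<open>The context above the redex absorbs \<open>x\<close>; for \<open>lam\<close> and
  \<open>ectx\<close> it remains a \<lambda>-context.\<close>

lemma step_hctx_HLam: "H \<rightarrow>\<^sub>H K \<Longrightarrow> HLam x H \<rightarrow>\<^sub>H HLam x K"
proof (induction rule: step_hctx.induct)
  case (lam L E y S)
  then show ?case using step_hctx.lam[of "HLam x L" E y S] by simp
next
  case (app E t H S)
  then show ?case using step_hctx.app[of E t "HLam x H" S] by simp
next
  case (ectx L E\<^sub>1 E\<^sub>2 S)
  then show ?case using step_hctx.ectx[of "HLam x L" E\<^sub>1 E\<^sub>2 S] by simp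
qed

lemma step_ectx_progress:
  "distinct_names (ctx E) \<Longrightarrow> \<not> canonical_ectx E \<Longrightarrow> \<exists>F. E \<rightarrow>\<^sub>E F"
proof (induction E)
  case (EApp E\<^sub>1 x E\<^sub>2 t)
  show ?case
  proof (cases "E\<^sub>1 = EHole")
    case True
    then have "distinct_names (ctx E\<^sub>2)" "\<not> canonical_ectx E\<^sub>2"
      using EApp.prems by (auto simp: distinct_names_def)
    then obtain F where "E\<^sub>2 \<rightarrow>\<^sub>E F" using EApp.IH by blast
    then show ?thesis
      using step_ectx.plug2[of E\<^sub>2 F "EApp EHole x EHole t"] True by auto
  next
    case False
    moreover have "fv t \<inter> SV (ctx E\<^sub>1) = {}"
      using EApp.prems by (auto simp: distinct_names_def names_hplug)
    ultimately show ?thesis using step_ectx.arg by blast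
  qed
qed auto

text \<open>The side condition of \<open>app\<close> is left out so that \<open>hctx_shape\<close>
  needs no names; the naming convention restores it in \<open>app_redex_step\<close>.\<close>

definition app_redex :: "hctx \<Rightarrow> bool" where
  "app_redex H \<longleftrightarrow> (\<exists>K E S t. E \<noteq> EHole \<and> H = K\<langle>HApp ((ctx E)\<langle>S\<rangle>) t\<rangle>)"

lemma app_redex_hplug: "app_redex H \<Longrightarrow> app_redex (K\<langle>H\<rangle>)"
  unfolding app_redex_def by (metis hplug_assoc)

lemma app_redex_step:
  assumes "distinct_names H" "app_redex H"
  shows "\<exists>K. H \<rightarrow>\<^sub>H K"
proof -
  obtain K E S t where E: "E \<noteq> EHole" and H: "H = K\<langle>HApp ((ctx E)\<langle>S\<rangle>) t\<rangle>"
    using assms(2) unfolding app_redex_def by blast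
  have "fv t \<inter> SV (ctx E) = {}"
    using assms(1) by (auto simp: H distinct_names_def names_hplug)
  then show ?thesis using E H step_hctx.app by blast
qed

lemma size_hplug: "size (H\<langle>K\<rangle>) = size H + size K"
  by (induction H) auto

text \<open>
  By whether the spine has an unmatched abstraction; if not, either a balanced block lies below
  an unmatched application, or the only such block is at the root.
\<close>

lemma hctx_shape:
  "(\<exists>E x S. H = (ctx E)\<langle>HLam x S\<rangle>) \<or> app_redex H \<or> (\<exists>E A. is_app_ctx A \<and> H = (ctx E)\<langle>A\<rangle>)"
\<comment> \<open>Structural induction would not reach \<open>S\<close> in the case
  \<open>lam\<close> below, which lies under a whole block.\<close>
proof (induction H rule: measure_induct_rule[of size])
  case (less H)
  let ?P = "\<lambda>H. (\<exists>E x S. H = (ctx E)\<langle>HLam x S\<rangle>) \<or> app_redex H \<or>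
    (\<exists>E A. is_app_ctx A \<and> H = (ctx E)\<langle>A\<rangle>)"
  have plug: "?P ((ctx F)\<langle>K\<rangle>)" if "?P K" for F K
    using that app_redex_hplug ctx_eplug hplug_assoc by metis
  show "?P H"
  proof (cases H)
    case Hole
    then have "is_app_ctx \<box> \<and> H = (ctx EHole)\<langle>\<box>\<rangle>" by simp
    then show ?thesis by blast
  next
    case (HLam x S)
    then have "H = (ctx EHole)\<langle>HLam x S\<rangle>" by simp
    then show ?thesis by blast
  next
    case (HApp K t)
    then consider (lam) E x S where "K = (ctx E)\<langle>HLam x S\<rangle>" | (redex) "app_redex K"
      | (app) E A where "is_app_ctx A" "K = (ctx E)\<langle>A\<rangle>"
      using less[of K] by auto
    then show ?thesis
    proof cases
      case lam
      \<comment> \<open>Here \<open>t\<close> is matched with \<open>x\<close>, so that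
        \<open>E\<close>, \<open>x\<close> and \<open>t\<close> form a larger block around
        \<open>S\<close>.\<close>
      have "?P S"
        using less[of S] HApp lam by (simp add: size_hplug)
      moreover have "H = (ctx (EApp E x EHole t))\<langle>S\<rangle>"
        using HApp lam by (simp add: hplug_assoc)
      ultimately show ?thesis using plug by metis
    next
      case redex
      then show ?thesis using HApp app_redex_hplug[of K "HApp \<box> t"] by simp
    next
      case app
      show ?thesis
      proof (cases "E = EHole")
        case True
        then have "is_app_ctx (HApp A t) \<and> H = (ctx EHole)\<langle>HApp A t\<rangle>"
          using app HApp by simp
        then show ?thesis by blast
      next
        case False
        then have "app_redex H"
          unfolding app_redex_def using app HApp hplug.simps(1) by metis
        then show ?thesis by blast
      qed
    qed
  qed
qed

lemma step_hctx_progress: "distinct_names H \<Longrightarrow> \<not> canonical_hctx H \<Longrightarrow> \<exists>K. H \<rightarrow>\<^sub>H K"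
proof (induction H)
  case Hole
  have "canonical_hctx (lams [] ((ctx EHole)\<langle>apps []\<rangle>))"
    unfolding canonical_hctx_iff by (metis canonical_ectx.simps(1))
  with Hole show ?case by (simp add: lams_def apps_def)
next
  case (HLam x H)
  have "\<not> canonical_hctx H"
  proof
    assume "canonical_hctx H"
    then obtain xs E ts where "canonical_ectx E" "H = lams xs ((ctx E)\<langle>apps ts\<rangle>)"
      by (auto simp: canonical_hctx_iff)
    then have "canonical_ectx E \<and> HLam x H = lams (x # xs) ((ctx E)\<langle>apps ts\<rangle>)"
      by (simp add: lams_def)
    with HLam.prems show False unfolding canonical_hctx_iff by blast
  qed
  moreover have "distinct_names H"
    using HLam.prems by (auto simp: distinct_names_def)
  ultimately show ?case using HLam.IH step_hctx_HLam by blast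
next
  case (HApp H' t)
  \<comment> \<open>The rules \<open>lam\<close> and \<open>ectx\<close> do not lift through an
    application, so the whole context is analysed and both are used with
    \<open>L = \<box>\<close>.\<close>
  define H where "H = HApp H' t"
  have H: "distinct_names H" "\<not> canonical_hctx H"
    using HApp.prems by (simp_all add: H_def)
  consider (lam) E x S where "H = (ctx E)\<langle>HLam x S\<rangle>" | (redex) "app_redex H"
    | (app) E A where "is_app_ctx A" "H = (ctx E)\<langle>A\<rangle>"
    using hctx_shape by blast
  then have "\<exists>K. H \<rightarrow>\<^sub>H K"
  proof cases
    case lam
    then have "E \<noteq> EHole" by (auto simp: H_def)
    moreover have "x \<notin> FV (ctx E)"
      using H(1) lam by (auto simp: distinct_names_def names_hplug)
    ultimately show ?thesis
      using step_hctx.lam[of \<box> E x S] lam by auto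
  next
    case redex
    then show ?thesis using H(1) app_redex_step by blast
  next
    case app
    have "canonical_hctx H" if "canonical_ectx E"
    proof -
      have "H = \<box>\<langle>(ctx E)\<langle>A\<rangle>\<rangle>" "is_lam_ctx \<box>" using app by simp_all
      then show ?thesis unfolding canonical_hctx_def using app that by blast
    qed
    then have "\<not> canonical_ectx E" using H(2) by blast
    moreover have "distinct_names (ctx E)"
      using H(1) app distinct_names_hplugD by blast
    ultimately obtain F where "E \<rightarrow>\<^sub>E F" using step_ectx_progress by blast
    then show ?thesis
      using step_hctx.ectx[of \<box> E F A] app by auto
  qed
  then show ?case by (simp add: H_def)
qed

section \<open>Existence and uniqueness of normal forms\<close>

lemma canonical_hctx_reachable:
  "distinct_names H \<Longrightarrow> \<exists>K. step_hctx\<^sup>*\<^sup>* H K \<and> canonical_hctx K"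
proof (induction H rule: measure_induct_rule[of inversions])
  case (less H)
  show ?case
  proof (cases "canonical_hctx H")
    case False
    then obtain K where K: "H \<rightarrow>\<^sub>H K"
      using less.prems step_hctx_progress by blast
    then have "distinct_names K"
      using less.prems step_hctx_sim sim_hctx_distinct_names by blast
    then obtain M where "step_hctx\<^sup>*\<^sup>* K M" "canonical_hctx M"
      using less.IH[OF step_hctx_inversions[OF K]] by blast
    with K show ?thesis by (meson converse_rtranclp_into_rtranclp)
  qed auto
qed

lemma canonical_hctx_normal:
  assumes "distinct_names H" "canonical_hctx H"
  shows "\<not> H \<rightarrow>\<^sub>H K"
proof
  assume HK: "H \<rightarrow>\<^sub>H K"
  then have "distinct_names K"
    using assms(1) step_hctx_sim sim_hctx_distinct_names by blast
  then obtain M where M: "step_hctx\<^sup>*\<^sup>* K M" "canonical_hctx M"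
    using canonical_hctx_reachable by blast
  have "H \<sim>\<^sub>H M"
    using HK M(1) step_hctx_sim steps_hctx_sim sim_hctx.trans by blast
  then have "M = H"
    using assms(2) M(2) canonical_hctx_eqI sim_hctx_invariant by metis
  then show False
    using step_hctx_inversions[OF HK] steps_hctx_inversions[OF M(1)] by simp
qed

text \<open>Progress makes normal forms canonical. Uniqueness needs no confluence argument, since
  the invariant identifies all canonical contexts equivalent to \<open>H\<close>.\<close>

lemma normal_form_of_iff:
  assumes "distinct_names H"
  shows "normal_form_of H N \<longleftrightarrow> canonical_hctx N \<and> N \<sim>\<^sub>H H"
proof
  assume "normal_form_of H N"
  then have N: "step_hctx\<^sup>*\<^sup>* H N" "\<nexists>K. N \<rightarrow>\<^sub>H K"
    by (auto simp: normal_form_of_def)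
  then have "H \<sim>\<^sub>H N" by (simp add: steps_hctx_sim)
  with assms N(2) show "canonical_hctx N \<and> N \<sim>\<^sub>H H"
    using step_hctx_progress sim_hctx_distinct_names sim_hctx.sym by blast
next
  assume N: "canonical_hctx N \<and> N \<sim>\<^sub>H H"
  obtain M where M: "step_hctx\<^sup>*\<^sup>* H M" "canonical_hctx M"
    using assms canonical_hctx_reachable by blast
  have "invariant N = invariant M"
    using N M(1) sim_hctx_invariant steps_hctx_sim by metis
  then have "M = N" using N M(2) canonical_hctx_eqI by metis
  then show "normal_form_of H N"
    using M assms N canonical_hctx_normal sim_hctx_distinct_names
    unfolding normal_form_of_def by blast
qed

section \<open>The decomposition of an H-context\<close>

primrec fill :: "var + trm \<Rightarrow> hctx \<Rightarrow> hctx" where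
  "fill (Inl x) K = HLam x K"
| "fill (Inr t) K = HApp K t"

text \<open>Joining both kinds of unmatched frames in one list turns the two chains of
  \<open>decomposition\<close> into one recursion. The intended lists have one block more than
  frames; other lengths get default values.\<close>

fun weave :: "(var + trm) list \<Rightarrow> ectx list \<Rightarrow> hctx" where
  "weave (c # cs) (E # Es) = (ctx E)\<langle>fill c (weave cs Es)\<rangle>"
| "weave [] (E # Es) = ctx E"
| "weave cs [] = \<box>"

abbreviation frames :: "var list \<Rightarrow> trm list \<Rightarrow> (var + trm) list" where
  "frames xs us \<equiv> map Inl xs @ map Inr us"

text \<open>
  Unlike in \<^const>\<open>profile\<close>, the arguments are listed from the root to the hole and the
  blocks between unmatched applications are kept apart.
\<close>

primrec parse :: "hctx \<Rightarrow> var list \<times> trm list \<times> ectx list" where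
  "parse \<box> = ([], [], [EHole])"
| "parse (HLam x H) = (case parse H of (xs, us, Es) \<Rightarrow> (x # xs, us, EHole # Es))"
| "parse (HApp H t) = (case parse H of (xs, us, Es) \<Rightarrow>
     (case xs of
        [] \<Rightarrow> ([], t # us, EHole # Es)
      | x # xs' \<Rightarrow> (xs', us, EApp (Es ! 0) x (Es ! 1) t # drop 2 Es)))"

lemma length_parse: "parse H = (xs, us, Es) \<Longrightarrow> length Es = Suc (length xs + length us)"
  by (induction H arbitrary: xs us Es) (auto split: prod.splits list.splits)

lemma weave_parse: "parse H = (xs, us, Es) \<Longrightarrow> weave (frames xs us) Es = H"
proof (induction H arbitrary: xs us Es)
  case (HApp H t)
  obtain ys vs Fs where p: "parse H = (ys, vs, Fs)" by (metis prod_cases3)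
  then have IH: "weave (frames ys vs) Fs = H" and len: "length Fs = Suc (length ys + length vs)"
    using HApp.IH length_parse by auto
  show ?case
  proof (cases ys)
    case Nil
    then show ?thesis using HApp.prems p IH by auto
  next
    case (Cons y ys')
    \<comment> \<open>By the length there are at least two blocks, so \<open>parse\<close> reads
      proper entries when it fuses them with \<open>y\<close> and \<open>t\<close>.\<close>
    then obtain F\<^sub>0 F\<^sub>1 Fs' where "Fs = F\<^sub>0 # F\<^sub>1 # Fs'"
      using len by (auto simp: length_Suc_conv)
    then show ?thesis using HApp.prems p IH Cons
      by (cases "frames ys' vs"; cases Fs') (auto simp: hplug_assoc)
  qed
qed (auto split: prod.splits)

lemma parse_ctx_hplug:
  "parse H = (xs, us, F # Fs) \<Longrightarrow> parse ((ctx E)\<langle>H\<rangle>) = (xs, us, eplug E F # Fs)"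
  by (induction E arbitrary: H xs F Fs) (auto simp: hplug_assoc)

text \<open>In \<open>frames\<close> all abstractions lie above all applications, so no frame is
  matched with another and \<open>parse\<close> finds the blocks unchanged. This yields uniqueness
  of the decomposition.\<close>

lemma parse_weave:
  "length Es = Suc (length xs + length us) \<Longrightarrow> parse (weave (frames xs us) Es) = (xs, us, Es)"
proof (induction "frames xs us" Es arbitrary: xs us rule: weave.induct)
  case (1 c cs E Es)
  show ?case
  proof (cases xs)
    case Nil
    then obtain vs t where us: "us = t # vs" and "c = Inr t" "cs = frames [] vs"
      using 1 by auto
    with 1 Nil have "parse (weave (frames [] vs) Es) = ([], vs, Es)"
      by (metis add_0 length_Cons list.size(3) nat.inject)
    then have "parse (HApp (weave (frames [] vs) Es) t) = ([], t # vs, EHole # Es)" by simp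
    from parse_ctx_hplug[OF this, of E] Nil us show ?thesis by simp
  next
    case (Cons x ys)
    then have "c = Inl x" "cs = frames ys us" using 1 by auto
    with 1 Cons have "parse (weave (frames ys us) Es) = (ys, us, Es)" by simp
    then have "parse (HLam x (weave (frames ys us) Es)) = (x # ys, us, EHole # Es)" by simp
    from parse_ctx_hplug[OF this, of E] Cons show ?thesis by simp
  qed
next
  case (2 E Es)
  then show ?case
    using parse_ctx_hplug[of \<box> "[]" "[]" EHole "[]" E] by (simp add: hplug_Hole)
qed auto

lemma invariant_weave:
  "length Es = Suc (length xs + length us) \<Longrightarrow>
     invariant (weave (frames xs us) Es) = (xs, rev us, concat (rev (map \<eta> Es)))"
proof (induction xs arbitrary: Es)
  case Nil
  \<comment> \<open>Without unmatched abstractions there is a single environment, and each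
    \<open>u\<close> is appended at the end, which reverses the root-to-hole order.\<close>
  have "profile (weave (frames [] us) Es) = ([], rev us, [concat (rev (map \<eta> Es))])"
    if "length Es = Suc (length us)" for Es
    using that
  proof (induction us arbitrary: Es)
    case Nil
    then obtain E where "Es = [E]" by (auto simp: length_Suc_conv)
    then show ?case
      using profile_ctx_hplug[of \<box> "[]" "[]" "[]" "[]" E] by (simp add: hplug_Hole)
  next
    case (Cons u us)
    then obtain E Fs where Es: "Es = E # Fs" "length Fs = Suc (length us)"
      by (auto simp: length_Suc_conv)
    then have "profile (HApp (weave (frames [] us) Fs) u)
        = ([], rev (u # us), [concat (rev (map \<eta> Fs))])"
      using Cons.IH by simp
    from profile_ctx_hplug[OF this, of E] Es show ?case by simp
  qed
  with Nil show ?case by (simp add: invariant_def)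
next
  case (Cons x xs)
  then obtain E Fs where Es: "Es = E # Fs" "length Fs = Suc (length xs + length us)"
    by (auto simp: length_Suc_conv)
  obtain ys ts es where p: "profile (weave (frames xs us) Fs) = (ys, ts, es)"
    by (metis prod_cases3)
  then have "profile (HLam x (weave (frames xs us) Fs)) = (x # ys, ts, [] # es)" by simp
  from profile_ctx_hplug[OF this, of E] Es Cons.IH[OF Es(2)] p show ?case
    by (simp add: invariant_def)
qed

text \<open>This makes \<open>canonical_sim_ectx_iff\<close> applicable to every block of the
  decomposition.\<close>

lemma weave_blocks_distinct:
  "distinct_names (weave cs Es) \<Longrightarrow> length Es = Suc (length cs) \<Longrightarrow> E \<in> set Es \<Longrightarrow>
     distinct_names (ctx E)"
proof (induction cs Es rule: weave.induct)
  case (1 c cs F Es)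
  have "weave (c # cs) (F # Es) = (ctx F)\<langle>(fill c \<box>)\<langle>weave cs Es\<rangle>\<rangle>"
    by (cases c) auto
  with 1 show ?case
    using distinct_names_hplugD by (metis length_Cons nat.inject set_ConsD)
qed auto

lemma spine_args_hplug: "spine_args (H\<langle>K\<rangle>) = spine_args H \<union> spine_args K"
  by (induction H) auto

text \<open>Supplies the membership conditions on \<open>xs\<close> and \<open>ts\<close> in
  \<open>decomposition\<close>.\<close>

lemma set_weave:
  "length Es = Suc (length cs) \<Longrightarrow>
     {x. Inl x \<in> set cs} \<subseteq> SV (weave cs Es) \<and> {t. Inr t \<in> set cs} \<subseteq> spine_args (weave cs Es)"
proof (induction cs Es rule: weave.induct)
  case (1 c cs E Es)
  then show ?case by (cases c) (auto simp: SV_hplug spine_args_hplug)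
qed auto

text \<open>\<open>Hs i\<close> is the part of the context from the \<open>i\<close>-th frame to the
  hole, so that removing the first frame is a shift of indices.\<close>

lemma weave_iff_chain:
  assumes "length Es = Suc (length cs)"
  shows "H = weave cs Es \<longleftrightarrow>
    (\<exists>Hs. H = (ctx (Es ! 0))\<langle>Hs 1\<rangle> \<and>
      (\<forall>i\<in>{1..length cs}. Hs i = fill (cs ! (i - 1)) ((ctx (Es ! i))\<langle>Hs (i + 1)\<rangle>)) \<and>
      Hs (length cs + 1) = \<box>)"
  using assms
proof (induction cs Es arbitrary: H rule: weave.induct)
  case (1 c cs E Es)
  have len: "length Es = Suc (length cs)" using 1 by simp
  let ?C = "\<lambda>cs Es Hs. \<forall>i\<in>{1..length cs}.
    Hs i = fill (cs ! (i - 1)) ((ctx (Es ! i))\<langle>Hs (i + 1)\<rangle>)"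
  show ?case
  proof
    assume H: "H = weave (c # cs) (E # Es)"
    obtain Hs where Hs: "weave cs Es = (ctx (Es ! 0))\<langle>Hs 1\<rangle>" "?C cs Es Hs"
        "Hs (length cs + 1) = \<box>"
      using 1(1)[OF len, of "weave cs Es"] by auto
    \<comment> \<open>The sequence for the tail moves up by one index to make room for the frame
      \<open>c\<close> at index 1.\<close>
    define Ks where "Ks i = (if i = 1 then fill c (weave cs Es) else Hs (i - 1))" for i
    have "Ks i = fill ((c # cs) ! (i - 1)) ((ctx ((E # Es) ! i))\<langle>Ks (i + 1)\<rangle>)"
      if "i \<in> {1..length (c # cs)}" for i
    proof (cases "i = 1")
      case True
      then show ?thesis using Hs(1) by (simp add: Ks_def)
    next
      case False
      then obtain j where "i = Suc j" "j \<in> {1..length cs}" using \<open>i \<in> _\<close> by (cases i) auto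
      then show ?thesis using Hs(2) by (cases j) (auto simp: Ks_def)
    qed
    moreover have "H = (ctx ((E # Es) ! 0))\<langle>Ks 1\<rangle>" "Ks (length (c # cs) + 1) = \<box>"
      using H Hs(3) by (auto simp: Ks_def)
    ultimately show "\<exists>Hs. H = (ctx ((E # Es) ! 0))\<langle>Hs 1\<rangle> \<and> ?C (c # cs) (E # Es) Hs \<and>
        Hs (length (c # cs) + 1) = \<box>"
      by blast
  next
    assume "\<exists>Hs. H = (ctx ((E # Es) ! 0))\<langle>Hs 1\<rangle> \<and> ?C (c # cs) (E # Es) Hs \<and>
        Hs (length (c # cs) + 1) = \<box>"
    then obtain Hs where Hs: "H = (ctx E)\<langle>Hs 1\<rangle>" "?C (c # cs) (E # Es) Hs"
        "Hs (length (c # cs) + 1) = \<box>"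
      by auto
    define Ks where "Ks i = Hs (Suc i)" for i
    have "Ks i = fill (cs ! (i - 1)) ((ctx (Es ! i))\<langle>Ks (i + 1)\<rangle>)" if "i \<in> {1..length cs}" for i
      using Hs(2)[rule_format, of "Suc i"] that by (cases i) (auto simp: Ks_def)
    moreover have "Ks (length cs + 1) = \<box>" using Hs(3) by (simp add: Ks_def)
    ultimately have "(ctx (Es ! 0))\<langle>Ks 1\<rangle> = weave cs Es"
      using 1(1)[OF len] by blast
    then show "H = weave (c # cs) (E # Es)"
      using Hs(1) Hs(2)[rule_format, of 1] by (simp add: Ks_def numeral_2_eq_2)
  qed
next
  case (2 E Es)
  show ?case by (auto simp: hplug_Hole intro: exI[of _ "\<lambda>_. \<box>"])
qed auto

lemma decomposition_iff_weave:
  "decomposition H xs ts Es \<longleftrightarrow>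
     length Es = Suc (length xs + length ts) \<and> H = weave (frames xs (rev ts)) Es"
proof -
  let ?n = "length xs" and ?m = "length ts" and ?cs = "frames xs (rev ts)"
  have "(\<forall>i\<in>{1..?n + ?m}. Hs i = fill (?cs ! (i - 1)) ((ctx (Es ! i))\<langle>Hs (i + 1)\<rangle>)) \<longleftrightarrow>
      (\<forall>i\<in>{1..?n}. Hs i = HLam (xs ! (i - 1)) ((ctx (Es ! i))\<langle>Hs (i + 1)\<rangle>)) \<and>
      (\<forall>j\<in>{1..?m}. Hs (?n + j) =
         HApp ((ctx (Es ! (?n + j)))\<langle>Hs (?n + j + 1)\<rangle>) (ts ! (?m - j)))"
    (is "(\<forall>i\<in>_. ?A i) \<longleftrightarrow> (\<forall>i\<in>_. ?B i) \<and> (\<forall>j\<in>_. ?C j)") for Hs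
  proof -
    \<comment> \<open>The index range splits into abstractions and applications; for the latter,
      \<open>rev ts ! (j - 1)\<close> is \<open>ts ! (m - j)\<close>.\<close>
    have "{1..?n + ?m} = {1..?n} \<union> (+) ?n ` {1..?m}"
      by (auto simp: image_add_atLeastAtMost)
    then have "(\<forall>i\<in>{1..?n + ?m}. ?A i) \<longleftrightarrow> (\<forall>i\<in>{1..?n}. ?A i) \<and> (\<forall>j\<in>{1..?m}. ?A (?n + j))"
      by (simp only: ball_Un ball_simps)
    moreover have "?A i \<longleftrightarrow> ?B i" if "i \<in> {1..?n}" for i
      using that by (auto simp: nth_append)
    moreover have "?A (?n + j) \<longleftrightarrow> ?C j" if "j \<in> {1..?m}" for j
      using that by (auto simp: nth_append rev_nth)
    ultimately show ?thesis by simp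
  qed
  then have "decomposition H xs ts Es \<longleftrightarrow> set xs \<subseteq> SV H \<and> set ts \<subseteq> spine_args H \<and>
      length Es = Suc (length ?cs) \<and> H = weave ?cs Es"
    unfolding decomposition_def Let_def using weave_iff_chain[of Es ?cs H] by auto
  moreover have "{x. Inl x \<in> set ?cs} = set xs" "{t. Inr t \<in> set ?cs} = set ts"
    by auto
  ultimately show ?thesis using set_weave[of Es ?cs] by auto
qed

lemma decomposition_unique_existence:
  "\<exists>!d. case d of (xs, ts, Es) \<Rightarrow> decomposition H xs ts Es"
proof -
  obtain xs us Es where p: "parse H = (xs, us, Es)" by (metis prod_cases3)
  show ?thesis
  proof (rule ex1I[of _ "(xs, rev us, Es)"])
    show "case (xs, rev us, Es) of (xs, ts, Es) \<Rightarrow> decomposition H xs ts Es"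
      using p length_parse weave_parse by (auto simp: decomposition_iff_weave)
    show "d = (xs, rev us, Es)" if "case d of (xs, ts, Es) \<Rightarrow> decomposition H xs ts Es" for d
      using that p parse_weave by (auto simp: decomposition_iff_weave split: prod.splits)
  qed
qed

theorem theorem12:
  fixes H :: hctx
  assumes "distinct_names H"
  shows "(\<exists>!H\<^sub>c. canonical_hctx H\<^sub>c \<and> H\<^sub>c \<sim>\<^sub>H H) \<and>
    (\<exists>!d. case d of (xs, ts, Es) \<Rightarrow> decomposition H xs ts Es) \<and>
    (\<forall>xs ts Es. decomposition H xs ts Es \<longrightarrow>
       (\<forall>E\<in>set Es. \<forall>F. (canonical_ectx F \<and> F \<sim>\<^sub>E E) \<longleftrightarrow> F = \<E> (\<eta> E)) \<and>
       (let E\<^sub>c = compose (map (\<lambda>E. \<E> (\<eta> E)) Es);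
            H\<^sub>c = lams xs ((ctx E\<^sub>c)\<langle>apps ts\<rangle>)
        in distinct_names H\<^sub>c \<and>
           (\<forall>K. (canonical_hctx K \<and> K \<sim>\<^sub>H H) \<longleftrightarrow> K = H\<^sub>c) \<and>
           (\<forall>N. normal_form_of H N \<longleftrightarrow> N = H\<^sub>c)))"
proof -
  obtain M where M: "canonical_hctx M" "M \<sim>\<^sub>H H"
    using assms canonical_hctx_reachable steps_hctx_sim sim_hctx.sym by blast
  have eq: "K = M" if "canonical_hctx K" "K \<sim>\<^sub>H H" for K
    using that M canonical_hctx_eqI sim_hctx_invariant by metis
  have M_iff: "canonical_hctx K \<and> K \<sim>\<^sub>H H \<longleftrightarrow> K = M" for K
    using M eq by blast
  have form: "lams xs ((ctx (compose (map (\<lambda>E. \<E> (\<eta> E)) Es)))\<langle>apps ts\<rangle>) = M"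
    if "decomposition H xs ts Es" for xs ts Es
  proof (rule canonical_hctx_eqI)
    let ?E = "compose (map (\<lambda>E. \<E> (\<eta> E)) Es)"
    have "canonical_ectx ?E"
      by (rule canonical_compose) (auto simp: canonical_ectx_of_env)
    then show "canonical_hctx (lams xs ((ctx ?E)\<langle>apps ts\<rangle>))"
      unfolding canonical_hctx_iff by blast
    \<comment> \<open>The environment of \<open>compose\<close> concatenates those of the blocks in
      the same reversed order, so both invariants agree.\<close>
    have "invariant H = (xs, ts, concat (rev (map \<eta> Es)))"
      using that invariant_weave[of Es xs "rev ts"] by (simp add: decomposition_iff_weave)
    then show "invariant (lams xs ((ctx ?E)\<langle>apps ts\<rangle>)) = invariant M"
      using sim_hctx_invariant[OF M(2)]
      by (simp add: invariant_canonical_form env_of_compose comp_def)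
  qed (rule M(1))
  have blocks: "distinct_names (ctx E)" if "decomposition H xs ts Es" "E \<in> set Es" for xs ts Es E
    using that assms weave_blocks_distinct[of "frames xs (rev ts)" Es E]
    by (simp add: decomposition_iff_weave)
  have "distinct_names M" using M(2) assms sim_hctx_distinct_names by blast
  then show ?thesis
    using M_iff form blocks canonical_sim_ectx_iff decomposition_unique_existence
      normal_form_of_iff[OF assms]
    by (simp add: Let_def)
qed

end
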